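(* Let $p_1,p_2>0$ and $q>0$. Let $A$ be the one-sided circle with $M$ nodes with $q_i^A=q$ for all $i$ and $p_i^A=p_1$ for $1\le i\le\frac M2$, $p_i^A=p_2$ for $\frac M2<i\le M$. Let $B$ be the one-sided circle with $M$ nodes with $q_i^B=q$ for all $i$ and $p_i^B=p_1$ for $i$ odd, $p_i^B=p_2$ for $i$ even, $1\le i\le M$. Let $f_A^{\rm het}(t)$, $f_B^{\rm het}(t)$ be the expected fractions of adopters. Then $$\lim_{M\to\infty}f_A^{\rm het}(t)=\frac{f_{\rm 1D}(t;p_1,q)+f_{\rm 1D}(t;p_2,q)}{2},\qquad f_{\rm 1D}(t;p,q):=1-e^{-(p+q)t+q\frac{1-e^{-pt}}{p}},$$ and $$\lim_{M\to\infty}f_B^{\rm het}(t)=1-\frac{1}{2q}e^{-qt}\big(\dot V_1(t)+\dot U_1(t)\big),$$ where $U_1,V_1$ are the solution of $$\dot U_1(t)=qe^{-p_1t}V_1(t),\quad U_1(0)=1,\qquad \dot V_1(t)=qe^{-p_2t}U_1(t),\quad V_1(0)=1.$$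
   Context: One-sided circle model: nodes $1,\dots,M$ with external rates $p_j$ and internal rates $q_j$. $X_j(t)\in\{0,1\}$ is the state of node $j$ ($1$ = adopter), $X_j(0)=0$ for all $j$. The process $(X_1,\dots,X_M)$ is a continuous-time Markov chain in which adopters remain adopters forever, and each nonadopter $j$ becomes an adopter at rate $p_j+q_jX_{j-1}(t)$ (one node changes at a time; node $0$ is identified with node $M$). The expected fraction of adopters is $f(t)=\frac1M\,\mathbf{E}\big[\sum_{j=1}^M X_j(t)\big]$. Dots denote $d/dt$. *)

theory Defs
  imports "HOL-Probability.Probability"
begin

text \<open>
  Continuous-time Markov chains on a finite state space \<open>S\<close>. The dynamics is given by the jump
  rates \<open>r x y\<close> for \<open>x \<noteq> y\<close>; the values \<open>r x x\<close> are ignored.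
\<close>

definition generator :: "'s set \<Rightarrow> ('s \<Rightarrow> 's \<Rightarrow> real) \<Rightarrow> 's \<Rightarrow> 's \<Rightarrow> real" where
  "generator S r x y = (if x = y then - (\<Sum>z\<in>S - {x}. r x z) else r x y)"

text \<open>
  \<open>P h x y\<close> is the probability of moving from \<open>x\<close> to \<open>y\<close> within time \<open>h\<close>. The last clause says
  \<open>P h x y = \<delta>\<^sub>x\<^sub>y + generator S r x y * h + o(h)\<close> as \<open>h\<close> decreases to 0.
\<close>

definition transition_function ::
    "'s set \<Rightarrow> ('s \<Rightarrow> 's \<Rightarrow> real) \<Rightarrow> (real \<Rightarrow> 's \<Rightarrow> 's \<Rightarrow> real) \<Rightarrow> bool" where
  "transition_function S r P \<longleftrightarrow>
     (\<forall>h\<ge>0. \<forall>x\<in>S. \<forall>y\<in>S. 0 \<le> P h x y) \<and>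
     (\<forall>h\<ge>0. \<forall>x\<in>S. (\<Sum>y\<in>S. P h x y) = 1) \<and>
     (\<forall>g\<ge>0. \<forall>h\<ge>0. \<forall>x\<in>S. \<forall>y\<in>S. P (g + h) x y = (\<Sum>z\<in>S. P g x z * P h z y)) \<and>
     (\<forall>x\<in>S. \<forall>y\<in>S. P 0 x y = (if x = y then 1 else 0)) \<and>
     (\<forall>x\<in>S. \<forall>y\<in>S. ((\<lambda>h. P h x y) has_real_derivative generator S r x y) (at 0 within {0..}))"

text \<open>
  The last clause is the (time-homogeneous) Markov property: given the states at finitely many
  times \<open>\<tau> 0 < \<dots> < \<tau> n\<close>, the state at time \<open>\<tau> n + h\<close> is distributed according to \<open>P h (x n)\<close>.
  No path regularity is required, since only the finite-dimensional distributions matter here.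
\<close>

definition markov_chain ::
    "'w measure \<Rightarrow> 's set \<Rightarrow> ('s \<Rightarrow> 's \<Rightarrow> real) \<Rightarrow> 's \<Rightarrow> (real \<Rightarrow> 'w \<Rightarrow> 's) \<Rightarrow> bool" where
  "markov_chain \<Omega> S r x0 X \<longleftrightarrow>
     prob_space \<Omega> \<and>
     finite S \<and>
     (\<forall>t\<ge>0. X t \<in> \<Omega> \<rightarrow>\<^sub>M count_space S) \<and>
     (AE \<omega> in \<Omega>. X 0 \<omega> = x0) \<and>
     (\<exists>P. transition_function S r P \<and>
        (\<forall>(n::nat) (\<tau>::nat \<Rightarrow> real) (x::nat \<Rightarrow> 's). \<forall>h\<ge>0. \<forall>y\<in>S.
           0 \<le> \<tau> 0 \<and> (\<forall>i<n. \<tau> i < \<tau> (Suc i)) \<and> (\<forall>i\<le>n. x i \<in> S) \<and>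
           \<P>(\<omega> in \<Omega>. \<forall>i\<le>n. X (\<tau> i) \<omega> = x i) > 0 \<longrightarrow>
           \<P>(\<omega> in \<Omega>. X (\<tau> n + h) \<omega> = y \<bar> \<forall>i\<le>n. X (\<tau> i) \<omega> = x i) = P h (x n) y))"

text \<open>
  The one-sided circle with nodes \<open>1, \<dots>, M\<close>. A state assigns to each node \<open>0\<close> (nonadopter) or
  \<open>1\<close> (adopter). The only possible jumps are \<open>x \<rightarrow> x(j := 1)\<close> with \<open>x j = 0\<close>, so adopters never
  revert and nodes change one at a time; for given \<open>x \<noteq> y\<close> at most one summand of the rate below
  is nonzero.
\<close>

definition circle_states :: "nat \<Rightarrow> (nat \<Rightarrow> nat) set" where
  "circle_states M = {1..M} \<rightarrow>\<^sub>E {0, 1}"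

definition circle_pred :: "nat \<Rightarrow> nat \<Rightarrow> nat" where
  "circle_pred M j = (if j = 1 then M else j - 1)"

definition circle_rate ::
    "nat \<Rightarrow> (nat \<Rightarrow> real) \<Rightarrow> (nat \<Rightarrow> real) \<Rightarrow> (nat \<Rightarrow> nat) \<Rightarrow> (nat \<Rightarrow> nat) \<Rightarrow> real" where
  "circle_rate M p q x y =
     (\<Sum>j\<in>{1..M}. if x j = 0 \<and> y = x(j := 1) then p j + q j * real (x (circle_pred M j)) else 0)"

definition one_sided_circle ::
    "'w measure \<Rightarrow> nat \<Rightarrow> (nat \<Rightarrow> real) \<Rightarrow> (nat \<Rightarrow> real) \<Rightarrow> (real \<Rightarrow> 'w \<Rightarrow> nat \<Rightarrow> nat) \<Rightarrow> bool" where
  "one_sided_circle \<Omega> M p q X \<longleftrightarrow>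
     markov_chain \<Omega> (circle_states M) (circle_rate M p q) (\<lambda>j\<in>{1..M}. 0) X"

definition adopter_fraction ::
    "'w measure \<Rightarrow> nat \<Rightarrow> (real \<Rightarrow> 'w \<Rightarrow> nat \<Rightarrow> nat) \<Rightarrow> real \<Rightarrow> real" where
  "adopter_fraction \<Omega> M X t = 1 / real M * (\<integral>\<omega>. (\<Sum>j\<in>{1..M}. real (X t \<omega> j)) \<partial>\<Omega>)"

definition f_1D :: "real \<Rightarrow> real \<Rightarrow> real \<Rightarrow> real" where
  "f_1D t p q = 1 - exp (- (p + q) * t + q * ((1 - exp (- p * t)) / p))"

end

theory Submission
  imports Defs
begin

text \<open>
  The probability that the arc \<open>i..j\<close> is still free of adopters satisfies, for \<open>i \<ge> 2\<close>, a linear ODE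
  whose only source term comes from the longer arc \<open>i - 1..j\<close>. Without the boundary at node 1 this
  hierarchy has the solution \<open>exp (- ((\<Sum>k=i..j. p k) + q) * s) * W i s\<close> with
  \<open>W i\<close>' \<open>= q * exp (- p (i - 1) * s) * W (i - 1) s\<close>; the hierarchy in \<open>W\<close> closes when \<open>p\<close> is
  constant or alternating. Starting from a bounded error at the first node of a
  block, each step to the right integrates the error once, so that \<open>n\<close> steps later it is at most a
  constant times \<open>(q * t) ^ n / n!\<close>. Summed over the nodes of a block the errors stay below a
  constant times \<open>exp (q * t)\<close>, so the fraction of adopters is within \<open>O(1 / M)\<close> of its limit.
\<close>

section \<open>Kolmogorov's forward equation on a finite state space\<close>

lemma transition_function_le_1:
  assumes "transition_function S r P" "finite S" "h \<ge> 0" "x \<in> S" "y \<in> S"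
  shows "P h x y \<le> 1"
proof -
  have "P h x y \<le> (\<Sum>y\<in>S. P h x y)"
    using assms by (intro member_le_sum) (auto simp: transition_function_def)
  then show ?thesis using assms by (auto simp: transition_function_def)
qed

text \<open>Chapman-Kolmogorov, split at the earlier of the two times. The derivative of
  \<open>P\<close> is given only at 0 and from the right, so increments to either side of
  \<open>t\<close> are expressed through the nonnegative time \<open>\<bar>s - t\<bar>\<close>;
  \<open>sgn\<close> and \<open>min\<close> merge the two cases.\<close>

lemma transition_function_increment:
  assumes P: "transition_function S r P" and "finite S" "s \<ge> 0" "t \<ge> 0" "x \<in> S" "y \<in> S"
  shows "P s x y - P t x y =
    sgn (s - t) * (\<Sum>z\<in>S. P (min s t) x z * (P \<bar>s - t\<bar> z y - P 0 z y))"
proof -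
  have *: "P (g + h) x y - P g x y = (\<Sum>z\<in>S. P g x z * (P h z y - P 0 z y))"
    if "g \<ge> 0" "h \<ge> 0" for g h
  proof -
    have "P (g + k) x y = (\<Sum>z\<in>S. P g x z * P k z y)" if "k \<ge> 0" for k
      using P that \<open>g \<ge> 0\<close> assms(5,6) unfolding transition_function_def by blast
    from this[OF \<open>h \<ge> 0\<close>] this[of 0] show ?thesis
      by (simp add: sum_subtractf right_diff_distrib)
  qed
  show ?thesis
    using *[of s "t - s"] *[of t "s - t"] assms(3,4)
    by (cases s t rule: linorder_cases) (auto simp: min_def abs_if)
qed

text \<open>Dividing the increment formula by \<open>s - t\<close> leaves a finite sum in which one
  factor tends to \<open>P t x z\<close> and the other to the generator entry, for \<open>s\<close>
  on either side of \<open>t\<close>.\<close>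

lemma transition_function_forward:
  assumes P: "transition_function S r P" and S: "finite S" "x \<in> S" "y \<in> S" and "t \<ge> 0"
  shows "((\<lambda>s. P s x y) has_real_derivative (\<Sum>z\<in>S. P t x z * generator S r z y))
    (at t within {0..})"
proof -
  let ?F = "at t within {0::real..}"
  have lim: "filterlim (\<lambda>s. \<bar>s - t\<bar>) (at 0 within {0..}) ?F"
    unfolding filterlim_at
  proof
    show "\<forall>\<^sub>F s in ?F. \<bar>s - t\<bar> \<in> {0..} \<and> \<bar>s - t\<bar> \<noteq> 0"
      by (auto simp: eventually_at_filter)
    have "((\<lambda>s. \<bar>s - t\<bar>) \<longlongrightarrow> \<bar>t - t\<bar>) ?F" by (intro tendsto_intros)
    then show "((\<lambda>s. \<bar>s - t\<bar>) \<longlongrightarrow> 0) ?F" by simp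
  qed
  have nonneg: "\<forall>\<^sub>F s in ?F. s \<ge> 0 \<and> s \<noteq> t"
    by (auto simp: eventually_at_filter)
  have D: "((\<lambda>h. (P h z w - P 0 z w) / h) \<longlongrightarrow> generator S r z w) (at 0 within {0..})"
    if "z \<in> S" "w \<in> S" for z w
  proof -
    have "((\<lambda>h. P h z w) has_real_derivative generator S r z w) (at 0 within {0..})"
      using P that unfolding transition_function_def by auto
    then show ?thesis by (simp add: has_field_derivative_iff)
  qed
  have c0: "((\<lambda>s. P \<bar>s - t\<bar> z w - P 0 z w) \<longlongrightarrow> 0) ?F" if "z \<in> S" "w \<in> S" for z w
  proof -
    have "((\<lambda>h. P h z w) has_real_derivative generator S r z w) (at 0 within {0..})"
      using P that unfolding transition_function_def by auto
    then have "((\<lambda>h. P h z w) \<longlongrightarrow> P 0 z w) (at 0 within {0..})"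
      by (rule DERIV_continuous[unfolded continuous_within])
    from filterlim_compose[OF this lim] show ?thesis
      by (simp add: LIM_zero_iff tendsto_diff[where b = "P 0 z w", OF _ tendsto_const, simplified])
  qed
  \<comment> \<open>For \<open>s < t\<close> the first factor of the increment formula sits at the
    moving time \<open>s\<close>, so continuity at \<open>t\<close> has to come first. It follows
    from the entries of \<open>P\<close> being at most 1 and from continuity at time 0.\<close>
  have cont: "((\<lambda>s. P s x w) \<longlongrightarrow> P t x w) ?F" if w: "w \<in> S" for w
  proof -
    have "((\<lambda>s. P s x w - P t x w) \<longlongrightarrow> 0) ?F"
    proof (rule Lim_null_comparison)
      show "((\<lambda>s. \<Sum>z\<in>S. \<bar>P \<bar>s - t\<bar> z w - P 0 z w\<bar>) \<longlongrightarrow> 0) ?F"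
        by (rule tendsto_null_sum) (use c0 w in \<open>auto intro: tendsto_rabs_zero\<close>)
      show "\<forall>\<^sub>F s in ?F. norm (P s x w - P t x w) \<le> (\<Sum>z\<in>S. \<bar>P \<bar>s - t\<bar> z w - P 0 z w\<bar>)"
        using nonneg
      proof eventually_elim
        case (elim s)
        have "\<bar>P (min s t) x z\<bar> \<le> 1" if "z \<in> S" for z
          using transition_function_le_1[OF P S(1), of "min s t" x z] P elim \<open>t \<ge> 0\<close> that S
          by (auto simp: transition_function_def)
        then have "\<bar>\<Sum>z\<in>S. P (min s t) x z * (P \<bar>s - t\<bar> z w - P 0 z w)\<bar>
            \<le> (\<Sum>z\<in>S. \<bar>P \<bar>s - t\<bar> z w - P 0 z w\<bar>)"
          by (intro order.trans[OF sum_abs] sum_mono) (auto simp: abs_mult intro!: mult_left_le_one_le)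
        with elim show ?case
          by (simp add: transition_function_increment[OF P S(1) _ \<open>t \<ge> 0\<close> S(2) w] abs_mult abs_sgn_eq)
      qed
    qed
    then show ?thesis by (simp add: LIM_zero_iff)
  qed
  have cmin: "((\<lambda>s. P (min s t) x w) \<longlongrightarrow> P t x w) ?F" if "w \<in> S" for w
  proof -
    have "((\<lambda>s. P (min s t) x w - P t x w) \<longlongrightarrow> 0) ?F"
    proof (rule Lim_null_comparison)
      show "((\<lambda>s. \<bar>P s x w - P t x w\<bar>) \<longlongrightarrow> 0) ?F"
        using cont[OF that] by (intro tendsto_rabs_zero) (simp add: LIM_zero_iff)
      show "\<forall>\<^sub>F s in ?F. norm (P (min s t) x w - P t x w) \<le> \<bar>P s x w - P t x w\<bar>"
        by (rule always_eventually) (simp add: min_def)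
    qed
    then show ?thesis by (simp add: LIM_zero_iff)
  qed
  have "((\<lambda>s. \<Sum>z\<in>S. P (min s t) x z * ((P \<bar>s - t\<bar> z y - P 0 z y) / \<bar>s - t\<bar>)) \<longlongrightarrow>
      (\<Sum>z\<in>S. P t x z * generator S r z y)) ?F"
    by (intro tendsto_sum tendsto_mult cmin filterlim_compose[OF D lim]) (use S in auto)
  then show ?thesis
    unfolding has_field_derivative_iff
  proof (rule Lim_transform_eventually)
    show "\<forall>\<^sub>F s in ?F. (\<Sum>z\<in>S. P (min s t) x z * ((P \<bar>s - t\<bar> z y - P 0 z y) / \<bar>s - t\<bar>)) =
        (P s x y - P t x y) / (s - t)"
      using nonneg
    proof eventually_elim
      case (elim s)
      \<comment> \<open>The sign in the increment formula turns the quotient by \<open>s - t\<close>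
        into one by \<open>\<bar>s - t\<bar>\<close>, so left and right quotients take the same
        form.\<close>
      then have "sgn (s - t) / (s - t) = 1 / \<bar>s - t\<bar>"
        by (cases "s < t") (auto simp: sgn_if divide_simps)
      then have "sgn (s - t) * c / (s - t) = c / \<bar>s - t\<bar>" for c
        by (metis mult.commute mult.right_neutral times_divide_eq_right)
      with elim show ?case
        by (simp only: transition_function_increment[OF P S(1) _ \<open>t \<ge> 0\<close> S(2,3)]
            sum_divide_distrib times_divide_eq_right)
    qed
  qed
qed

section \<open>Laws and expectations of a Markov chain at a single time\<close>

text \<open>The Markov property with \<open>n = 0\<close> and \<open>\<tau> 0 = 0\<close> conditions
  on an event of probability 1, which leaves the unconditional law.\<close>

lemma markov_chain_law:
  assumes X: "markov_chain \<Omega> S r x0 X" and "x0 \<in> S"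
  obtains P where "transition_function S r P"
    "\<And>t y. t \<ge> 0 \<Longrightarrow> y \<in> S \<Longrightarrow> \<P>(\<omega> in \<Omega>. X t \<omega> = y) = P t x0 y"
proof -
  interpret prob_space \<Omega> using X by (simp add: markov_chain_def)
  have meas: "{\<omega> \<in> space \<Omega>. X t \<omega> = y} \<in> events" if "t \<ge> 0" for t y
  proof -
    have [measurable]: "X t \<in> \<Omega> \<rightarrow>\<^sub>M count_space S"
      using X that by (simp add: markov_chain_def)
    show ?thesis by measurable
  qed
  have "AE \<omega> in \<Omega>. X 0 \<omega> = x0" using X by (simp add: markov_chain_def)
  then have one: "\<P>(\<omega> in \<Omega>. X 0 \<omega> = x0) = 1"
    by (subst prob_Collect_eq_1) (use meas in auto)
  from X obtain P where P: "transition_function S r P" and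
    cond: "\<And>(n::nat) (\<tau>::nat \<Rightarrow> real) (x::nat \<Rightarrow> _) h y. h \<ge> 0 \<Longrightarrow> y \<in> S \<Longrightarrow>
           0 \<le> \<tau> 0 \<and> (\<forall>i<n. \<tau> i < \<tau> (Suc i)) \<and> (\<forall>i\<le>n. x i \<in> S) \<and>
           \<P>(\<omega> in \<Omega>. \<forall>i\<le>n. X (\<tau> i) \<omega> = x i) > 0 \<Longrightarrow>
           \<P>(\<omega> in \<Omega>. X (\<tau> n + h) \<omega> = y \<bar> \<forall>i\<le>n. X (\<tau> i) \<omega> = x i) = P h (x n) y"
    unfolding markov_chain_def by blast
  have "\<P>(\<omega> in \<Omega>. X t \<omega> = y) = P t x0 y" if "t \<ge> 0" "y \<in> S" for t y
  proof -
    have "\<P>(\<omega> in \<Omega>. X t \<omega> = y) = \<P>(\<omega> in \<Omega>. X t \<omega> = y \<and> X 0 \<omega> = x0)"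
    proof (rule finite_measure_eq_AE)
      show "{\<omega> \<in> space \<Omega>. X t \<omega> = y \<and> X 0 \<omega> = x0} \<in> events"
        using meas that by (intro sets.sets_Collect_conj) auto
    qed (use meas that \<open>AE \<omega> in \<Omega>. X 0 \<omega> = x0\<close> in auto)
    also have "\<dots> = P t x0 y"
      using cond[of t y "\<lambda>_. 0" 0 "\<lambda>_. x0"] that one \<open>x0 \<in> S\<close> by (simp add: cond_prob_def)
    finally show ?thesis .
  qed
  with P that show thesis by blast
qed

text \<open>Finitely many states make \<open>g (X t \<omega>)\<close> a finite combination of
  indicators, whatever \<open>g\<close> is.\<close>

lemma markov_chain_expectation:
  fixes g :: "'s \<Rightarrow> real"
  assumes X: "markov_chain \<Omega> S r x0 X" and "t \<ge> 0"
  shows "integrable \<Omega> (\<lambda>\<omega>. g (X t \<omega>))"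
    and "(\<integral>\<omega>. g (X t \<omega>) \<partial>\<Omega>) = (\<Sum>y\<in>S. \<P>(\<omega> in \<Omega>. X t \<omega> = y) * g y)"
proof -
  interpret prob_space \<Omega> using X by (simp add: markov_chain_def)
  have "finite S" and [measurable]: "X t \<in> \<Omega> \<rightarrow>\<^sub>M count_space S"
    using X \<open>t \<ge> 0\<close> by (auto simp: markov_chain_def)
  have meas: "{\<omega> \<in> space \<Omega>. X t \<omega> = y} \<in> events" for y by measurable
  have eq: "g (X t \<omega>) = (\<Sum>y\<in>S. indicator {\<omega> \<in> space \<Omega>. X t \<omega> = y} \<omega> * g y)"
    if "\<omega> \<in> space \<Omega>" for \<omega>
  proof -
    have "X t \<omega> \<in> S"
      using measurable_space[OF \<open>X t \<in> \<Omega> \<rightarrow>\<^sub>M count_space S\<close> that] by simp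
    have "(\<Sum>y\<in>S. indicator {\<omega> \<in> space \<Omega>. X t \<omega> = y} \<omega> * g y) =
        (\<Sum>y\<in>S. if X t \<omega> = y then g y else 0)"
      using that by (intro sum.cong) auto
    with \<open>finite S\<close> \<open>X t \<omega> \<in> S\<close> show ?thesis by simp
  qed
  have int: "integrable \<Omega> (\<lambda>\<omega>. indicator {\<omega> \<in> space \<Omega>. X t \<omega> = y} \<omega> * g y)" for y
    using meas by (intro integrable_mult_left integrable_real_indicator) (auto simp: emeasure_eq_measure)
  show "integrable \<Omega> (\<lambda>\<omega>. g (X t \<omega>))"
    by (subst Bochner_Integration.integrable_cong[OF refl eq]) (auto intro: int)
  have "(\<integral>\<omega>. g (X t \<omega>) \<partial>\<Omega>) =
      (\<integral>\<omega>. (\<Sum>y\<in>S. indicator {\<omega> \<in> space \<Omega>. X t \<omega> = y} \<omega> * g y) \<partial>\<Omega>)"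
    by (intro Bochner_Integration.integral_cong refl eq)
  also have "\<dots> = (\<Sum>y\<in>S. \<P>(\<omega> in \<Omega>. X t \<omega> = y) * g y)"
    by (subst Bochner_Integration.integral_sum[OF int])
       (intro sum.cong refl, simp add: Int_absorb1)
  finally show "(\<integral>\<omega>. g (X t \<omega>) \<partial>\<Omega>) = (\<Sum>y\<in>S. \<P>(\<omega> in \<Omega>. X t \<omega> = y) * g y)" .
qed

text \<open>The diagonal entry of the generator supplies exactly the terms
  \<open>- g x\<close>.\<close>

lemma sum_generator:
  assumes "finite S" "x \<in> S"
  shows "(\<Sum>y\<in>S. generator S r x y * g y) = (\<Sum>y\<in>S - {x}. r x y * (g y - g x))"
proof -
  have "(\<Sum>y\<in>S. generator S r x y * g y) =
      - (\<Sum>z\<in>S - {x}. r x z) * g x + (\<Sum>y\<in>S - {x}. r x y * g y)"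
  proof -
    have "(\<Sum>y\<in>S - {x}. generator S r x y * g y) = (\<Sum>y\<in>S - {x}. r x y * g y)"
      by (intro sum.cong) (auto simp: generator_def)
    then show ?thesis
      using sum.remove[OF assms, of "\<lambda>y. generator S r x y * g y"] by (simp add: generator_def)
  qed
  then show ?thesis
    by (simp add: right_diff_distrib sum_subtractf sum_distrib_right)
qed

text \<open>Dynkin's formula in differential form: the forward equation is summed against
  \<open>g\<close>, and exchanging the two finite sums moves the generator from the law onto
  \<open>g\<close>.\<close>

lemma markov_chain_expectation_deriv:
  fixes g :: "'s \<Rightarrow> real"
  assumes X: "markov_chain \<Omega> S r x0 X" and "x0 \<in> S" "t \<ge> 0"
    and Lg: "\<And>x. x \<in> S \<Longrightarrow> (\<Sum>y\<in>S - {x}. r x y * (g y - g x)) = Lg x"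
  shows "((\<lambda>s. \<integral>\<omega>. g (X s \<omega>) \<partial>\<Omega>) has_real_derivative (\<integral>\<omega>. Lg (X t \<omega>) \<partial>\<Omega>))
    (at t within {0..})"
proof -
  have S: "finite S" using X by (simp add: markov_chain_def)
  obtain P where P: "transition_function S r P"
    and law: "\<And>t y. t \<ge> 0 \<Longrightarrow> y \<in> S \<Longrightarrow> \<P>(\<omega> in \<Omega>. X t \<omega> = y) = P t x0 y"
    using markov_chain_law[OF X \<open>x0 \<in> S\<close>] by blast
  have E: "(\<integral>\<omega>. g (X s \<omega>) \<partial>\<Omega>) = (\<Sum>y\<in>S. P s x0 y * g y)" if "s \<ge> 0" for s and g :: "'s \<Rightarrow> real"
    using that law by (simp add: markov_chain_expectation(2)[OF X])
  have "((\<lambda>s. \<Sum>y\<in>S. P s x0 y * g y) has_real_derivative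
      (\<Sum>y\<in>S. (\<Sum>z\<in>S. P t x0 z * generator S r z y) * g y)) (at t within {0..})"
    by (intro DERIV_sum DERIV_cmult_right transition_function_forward[OF P]) (use S assms in auto)
  also have "(\<Sum>y\<in>S. (\<Sum>z\<in>S. P t x0 z * generator S r z y) * g y) =
      (\<Sum>z\<in>S. P t x0 z * (\<Sum>y\<in>S. generator S r z y * g y))"
    by (simp add: sum_distrib_left sum_distrib_right mult.assoc) (rule sum.swap)
  also have "\<dots> = (\<integral>\<omega>. Lg (X t \<omega>) \<partial>\<Omega>)"
    using S Lg by (simp add: E \<open>t \<ge> 0\<close> sum_generator cong: sum.cong)
  finally show ?thesis
    by (rule has_field_derivative_transform_within[where d = 1]) (use E \<open>t \<ge> 0\<close> in auto)
qed

section \<open>Vacant arcs of the circle\<close>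

text \<open>Real-valued, so that the generator applies to it directly and its expectation is the
  probability of a vacant arc.\<close>

definition vacant :: "nat \<Rightarrow> nat \<Rightarrow> (nat \<Rightarrow> nat) \<Rightarrow> real" where
  "vacant i j x = of_bool (\<forall>k\<in>{i..j}. x k = 0)"

text \<open>After the sums are exchanged, each node in state 0 contributes exactly one target,
  \<open>x(j := 1)\<close>, which is again a state and differs from \<open>x\<close>.\<close>

lemma circle_generator:
  assumes x: "x \<in> circle_states M"
  shows "(\<Sum>y\<in>circle_states M - {x}. circle_rate M p q x y * (g y - g x)) =
    (\<Sum>j\<in>{1..M}. if x j = 0
      then (p j + q j * real (x (circle_pred M j))) * (g (x(j := 1)) - g x) else 0)"
proof -
  have fin: "finite (circle_states M)" by (simp add: circle_states_def finite_PiE)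
  have "(\<Sum>y\<in>circle_states M - {x}. circle_rate M p q x y * (g y - g x)) =
      (\<Sum>j\<in>{1..M}. \<Sum>y\<in>circle_states M - {x}. (if x j = 0 \<and> y = x(j := 1)
        then p j + q j * real (x (circle_pred M j)) else 0) * (g y - g x))"
    by (subst sum.swap) (simp add: circle_rate_def sum_distrib_right)
  also have "\<dots> = (\<Sum>j\<in>{1..M}. if x j = 0
      then (p j + q j * real (x (circle_pred M j))) * (g (x(j := 1)) - g x) else 0)"
  proof (rule sum.cong[OF refl])
    fix j assume j: "j \<in> {1..M}"
    have mem: "x(j := 1) \<in> circle_states M - {x}" if "x j = 0"
    proof -
      have "(x(j := 1)) j \<noteq> x j" using that by simp
      then have "x(j := 1) \<noteq> x" by metis
      then show ?thesis using x j by (auto simp: circle_states_def PiE_iff extensional_def)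
    qed
    show "(\<Sum>y\<in>circle_states M - {x}. (if x j = 0 \<and> y = x(j := 1)
        then p j + q j * real (x (circle_pred M j)) else 0) * (g y - g x)) =
      (if x j = 0 then (p j + q j * real (x (circle_pred M j))) * (g (x(j := 1)) - g x) else 0)"
      using mem fin
      by (cases "x j = 0") (auto simp: if_distrib[where f = "\<lambda>u. u * _"] sum.delta cong: if_cong)
  qed
  finally show ?thesis .
qed

text \<open>Only an adoption inside the arc changes \<open>vacant i j\<close>. In a vacant arc every
  node except \<open>i\<close> has a nonadopting predecessor, so \<open>q\<close> enters only
  through \<open>x (i - 1)\<close>, and \<open>vacant i j x * x (i - 1)\<close> is
  \<open>vacant i j x - vacant (i - 1) j x\<close>. With \<open>2 \<le> i\<close> the predecessor of
  \<open>i\<close> does not wrap around to \<open>M\<close>.\<close>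

lemma circle_generator_vacant:
  assumes x: "x \<in> circle_states M" and "2 \<le> i" "i \<le> j" "j \<le> M"
  shows "(\<Sum>y\<in>circle_states M - {x}. circle_rate M p (\<lambda>_. q) x y * (vacant i j y - vacant i j x)) =
    - ((\<Sum>k=i..j. p k) + q) * vacant i j x + q * vacant (i - 1) j x"
proof (cases "\<forall>k\<in>{i..j}. x k = 0")
  \<comment> \<open>An adopter in the arc survives every jump, so both sides are 0.\<close>
  case False
  then obtain l where l: "l \<in> {i..j}" "x l \<noteq> 0" by blast
  have "vacant i j (x(k := 1)) = 0" for k
    using l by (auto simp: vacant_def intro: bexI[of _ l])
  moreover have "vacant i j x = 0" "vacant (i - 1) j x = 0"
    using l by (auto simp: vacant_def intro: bexI[of _ l])
  ultimately show ?thesis by (subst circle_generator[OF x]) (simp cong: if_cong)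
next
  case True
  have v: "vacant i j x = 1" using True by (simp add: vacant_def)
  have v': "vacant i j (x(k := 1)) = of_bool (k \<notin> {i..j})" for k
    using True by (auto simp: vacant_def)
  have "x (i - 1) \<in> {0, 1}"
    using x unfolding circle_states_def by (rule PiE_mem) (use assms in auto)
  moreover have "{i - 1..j} = insert (i - 1) {i..j}" using assms by auto
  ultimately have v1: "vacant (i - 1) j x = 1 - real (x (i - 1))"
    using True by (auto simp: vacant_def)
  have "(\<Sum>k\<in>{1..M}. if x k = 0
      then (p k + q * real (x (circle_pred M k))) * (vacant i j (x(k := 1)) - vacant i j x) else 0)
    = (\<Sum>k=i..j. - (p k + (if k = i then q * real (x (i - 1)) else 0)))"
    unfolding v v'
  proof (rule sum.mono_neutral_cong_right)
    fix k assume k: "k \<in> {i..j}"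
    have "x (circle_pred M k) = (if k = i then x (i - 1) else 0)"
    proof (cases "k = i")
      case False
      with k have "k - 1 \<in> {i..j}" by auto
      then have "x (k - 1) = 0" using True by blast
      then show ?thesis using False k assms by (simp add: circle_pred_def)
    qed (use assms in \<open>simp add: circle_pred_def\<close>)
    then show "(if x k = 0 then (p k + q * real (x (circle_pred M k))) * (of_bool (k \<notin> {i..j}) - 1) else 0)
        = - (p k + (if k = i then q * real (x (i - 1)) else 0))"
      using k True by simp
  qed (use assms in auto)
  also have "\<dots> = - (\<Sum>k=i..j. p k) - q * real (x (i - 1))"
    using assms by (simp add: sum_negf sum.distrib del: minus_add_distrib)
  finally show ?thesis
    unfolding circle_generator[OF x] by (simp only: v v1) (simp add: algebra_simps)
qed

lemma circle_vacant_deriv: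
  assumes X: "one_sided_circle \<Omega> M p (\<lambda>_. q) X" and ij: "2 \<le> i" "i \<le> j" "j \<le> M" and "t \<ge> 0"
  shows "((\<lambda>s. \<integral>\<omega>. vacant i j (X s \<omega>) \<partial>\<Omega>) has_real_derivative
    - ((\<Sum>k=i..j. p k) + q) * (\<integral>\<omega>. vacant i j (X t \<omega>) \<partial>\<Omega>) +
    q * (\<integral>\<omega>. vacant (i - 1) j (X t \<omega>) \<partial>\<Omega>)) (at t within {0..})"
proof -
  note mc = X[unfolded one_sided_circle_def]
  have "(\<lambda>j\<in>{1..M}. 0) \<in> circle_states M" by (auto simp: circle_states_def)
  from markov_chain_expectation_deriv[OF mc this \<open>t \<ge> 0\<close> circle_generator_vacant[OF _ ij]]
  show ?thesis
    using markov_chain_expectation(1)[OF mc \<open>t \<ge> 0\<close>] by simp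
qed

lemma circle_vacant_bounds:
  assumes X: "one_sided_circle \<Omega> M p q X" and "t \<ge> 0"
  shows "\<bar>\<integral>\<omega>. vacant i j (X t \<omega>) \<partial>\<Omega>\<bar> \<le> 1"
proof -
  note mc = X[unfolded one_sided_circle_def]
  interpret prob_space \<Omega> using mc by (simp add: markov_chain_def)
  have "\<bar>\<integral>\<omega>. vacant i j (X t \<omega>) \<partial>\<Omega>\<bar> \<le> (\<integral>\<omega>. \<bar>vacant i j (X t \<omega>)\<bar> \<partial>\<Omega>)"
    by (rule integral_abs_bound)
  also have "\<dots> \<le> (\<integral>\<omega>. 1 \<partial>\<Omega>)"
    using markov_chain_expectation(1)[OF mc \<open>t \<ge> 0\<close>, of "vacant i j"]
    by (intro integral_mono) (auto simp: vacant_def)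
  finally show ?thesis by (simp add: prob_space)
qed

lemma circle_vacant_0:
  assumes X: "one_sided_circle \<Omega> M p q X" and "1 \<le> i" "j \<le> M"
  shows "(\<integral>\<omega>. vacant i j (X 0 \<omega>) \<partial>\<Omega>) = 1"
proof -
  note mc = X[unfolded one_sided_circle_def]
  interpret prob_space \<Omega> using mc by (simp add: markov_chain_def)
  have "AE \<omega> in \<Omega>. X 0 \<omega> = (\<lambda>j\<in>{1..M}. 0)" using mc by (simp add: markov_chain_def)
  then have "AE \<omega> in \<Omega>. vacant i j (X 0 \<omega>) = 1"
    by eventually_elim (use assms in \<open>auto simp: vacant_def\<close>)
  then have "(\<integral>\<omega>. vacant i j (X 0 \<omega>) \<partial>\<Omega>) = (\<integral>\<omega>. 1 \<partial>\<Omega>)"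
    using markov_chain_expectation(1)[OF mc order.refl, of "vacant i j"]
    by (intro integral_cong_AE) auto
  then show ?thesis by (simp add: prob_space)
qed

text \<open>States take only the values 0 and 1, so the state of a node is the complement of the
  indicator of its one-node arc.\<close>

lemma adopter_fraction_vacant:
  assumes X: "one_sided_circle \<Omega> M p q X" and "t \<ge> 0" "M \<ge> 1"
  shows "adopter_fraction \<Omega> M X t = 1 - (\<Sum>j=1..M. \<integral>\<omega>. vacant j j (X t \<omega>) \<partial>\<Omega>) / real M"
proof -
  note mc = X[unfolded one_sided_circle_def]
  interpret prob_space \<Omega> using mc by (simp add: markov_chain_def)
  have int: "integrable \<Omega> (\<lambda>\<omega>. vacant j j (X t \<omega>))" for j
    by (rule markov_chain_expectation(1)[OF mc \<open>t \<ge> 0\<close>])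
  have "(\<integral>\<omega>. (\<Sum>j\<in>{1..M}. real (X t \<omega> j)) \<partial>\<Omega>) =
      (\<integral>\<omega>. (\<Sum>j\<in>{1..M}. 1 - vacant j j (X t \<omega>)) \<partial>\<Omega>)"
  proof (intro Bochner_Integration.integral_cong sum.cong refl)
    fix \<omega> j assume "\<omega> \<in> space \<Omega>" "j \<in> {1..M}"
    moreover have "X t \<in> \<Omega> \<rightarrow>\<^sub>M count_space (circle_states M)"
      using mc \<open>t \<ge> 0\<close> by (simp add: markov_chain_def)
    ultimately have "X t \<omega> \<in> circle_states M"
      using measurable_space[of "X t" \<Omega> "count_space (circle_states M)" \<omega>] by simp
    with \<open>j \<in> {1..M}\<close> have "X t \<omega> j \<in> {0, 1}"
      unfolding circle_states_def by (rule PiE_mem[rotated -1])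
    then show "real (X t \<omega> j) = 1 - vacant j j (X t \<omega>)" by (auto simp: vacant_def)
  qed
  also have "\<dots> = (\<Sum>j\<in>{1..M}. 1 - (\<integral>\<omega>. vacant j j (X t \<omega>) \<partial>\<Omega>))"
    using int by (simp add: prob_space)
  also have "\<dots> = real M - (\<Sum>j=1..M. \<integral>\<omega>. vacant j j (X t \<omega>) \<partial>\<Omega>)"
    by (simp add: sum_subtractf)
  finally show ?thesis
    using \<open>M \<ge> 1\<close> by (simp add: adopter_fraction_def field_simps)
qed

section \<open>Propagation of the error along the arcs\<close>

text \<open>Comparison with the integral of the bound on the source; the damping term with
  \<open>a \<ge> 0\<close> can only shrink the error.\<close>

lemma linear_ode_power_bound:
  fixes E g :: "real \<Rightarrow> real"
  assumes E: "\<And>s. s \<ge> 0 \<Longrightarrow> (E has_real_derivative - a * E s + q * g s) (at s within {0..})"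
    and "E 0 = 0" "a \<ge> 0" "q \<ge> 0" "C \<ge> 0" "t \<ge> 0"
    and g: "\<And>s. 0 \<le> s \<Longrightarrow> s \<le> t \<Longrightarrow> \<bar>g s\<bar> \<le> C * (q * s) ^ n / fact n"
  shows "\<bar>E t\<bar> \<le> C * (q * t) ^ Suc n / fact (Suc n)"
proof -
  \<comment> \<open>\<open>G\<close> is the integral from 0 of \<open>q\<close> times the assumed
    bound on \<open>g\<close>; the exponent \<open>Suc n\<close> makes
    \<open>G 0 = 0\<close>.\<close>
  define G where "G s = C * (q * s) ^ Suc n / fact (Suc n)" for s
  have G: "(G has_real_derivative q * (C * (q * s) ^ n / fact n)) (at s within {0..})" for s
    unfolding G_def
    by (rule derivative_eq_intros refl | simp)+
  have bound: "\<sigma> * E t \<le> G t" if \<sigma>: "\<sigma> = 1 \<or> \<sigma> = -1" for \<sigma> :: real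
  proof -
    \<comment> \<open>The integrating factor removes \<open>E\<close> from the derivative of
      \<open>F\<close>. What remains is nonpositive, so \<open>F\<close> decreases from 0.\<close>
    define F where "F s = exp (a * s) * (\<sigma> * E s - G s)" for s
    have F: "(F has_real_derivative
        exp (a * s) * (q * (\<sigma> * g s - C * (q * s) ^ n / fact n) - a * G s)) (at s within {0..})"
      if "s \<ge> 0" for s
      unfolding F_def
      by (rule derivative_eq_intros refl E[OF that] G | simp)+ (simp add: algebra_simps)
    have "F t \<le> F 0"
    proof (rule DERIV_nonpos_imp_decreasing_open[OF \<open>t \<ge> 0\<close>])
      fix s assume s: "0 < s" "s < t"
      have "\<sigma> * g s \<le> C * (q * s) ^ n / fact n"
        using g[of s] s \<sigma> by auto
      moreover have "G s \<ge> 0" unfolding G_def using assms s by simp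
      ultimately have "exp (a * s) * (q * (\<sigma> * g s - C * (q * s) ^ n / fact n) - a * G s) \<le> 0"
        using \<open>a \<ge> 0\<close> \<open>q \<ge> 0\<close>
        by (intro mult_nonneg_nonpos) (auto simp: mult_nonneg_nonpos intro: order.trans[of _ 0])
      moreover have "at s within {0..} = at s"
        using s by (intro at_within_interior) (simp add: interior_real_atLeast)
      ultimately show "\<exists>y. DERIV F s :> y \<and> y \<le> 0"
        using F[of s] s by auto
    next
      show "continuous_on {0..t} F"
        by (rule DERIV_continuous_on, rule DERIV_subset[OF F]) auto
    qed
    then show ?thesis
      using \<open>E 0 = 0\<close> by (simp add: F_def G_def mult_le_0_iff)
  qed
  from bound[of 1] bound[of "-1"] show ?thesis by (simp add: G_def abs_le_iff)
qed

text \<open>Induction on \<open>n\<close> moves the left end of the arc away from \<open>a\<close>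
  while \<open>j\<close> stays fixed. At \<open>a\<close> the two terms are bounded separately, the
  probability by 1 and the approximation by \<open>C\<close>, which gives the constant
  \<open>C + 1\<close>.\<close>

lemma circle_vacant_approx:
  fixes W :: "nat \<Rightarrow> real \<Rightarrow> real"
  assumes X: "one_sided_circle \<Omega> M p (\<lambda>_. q) X" and "q \<ge> 0" and p: "\<And>k. p k \<ge> 0"
    and a: "1 \<le> a" and "a + n \<le> j" "j \<le> M"
    and W: "\<And>i s. a < i \<Longrightarrow> i \<le> j \<Longrightarrow> s \<ge> 0 \<Longrightarrow>
      (W i has_real_derivative q * exp (- p (i - 1) * s) * W (i - 1) s) (at s within {0..})"
    and W0: "\<And>i. W i 0 = 1"
    and C: "\<And>s. 0 \<le> s \<Longrightarrow> s \<le> T \<Longrightarrow> \<bar>W a s\<bar> \<le> C"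
    and "0 \<le> t" "t \<le> T"
  shows "\<bar>(\<integral>\<omega>. vacant (a + n) j (X t \<omega>) \<partial>\<Omega>) -
      exp (- ((\<Sum>k=a + n..j. p k) + q) * t) * W (a + n) t\<bar> \<le> (C + 1) * (q * t) ^ n / fact n"
  using \<open>a + n \<le> j\<close> \<open>0 \<le> t\<close> \<open>t \<le> T\<close>
proof (induction n arbitrary: t)
  case 0
  have "exp (- ((\<Sum>k=a..j. p k) + q) * t) \<le> 1"
    using 0 \<open>q \<ge> 0\<close> p
    by (simp only: exp_le_one_iff)
       (intro mult_nonpos_nonneg, auto simp del: minus_add_distrib intro!: sum_nonneg add_nonneg_nonneg)
  then have "\<bar>exp (- ((\<Sum>k=a..j. p k) + q) * t) * W a t\<bar> \<le> 1 * C"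
    unfolding abs_mult using 0 C[of t] by (intro mult_mono) auto
  then show ?case using circle_vacant_bounds[OF X \<open>0 \<le> t\<close>, of a j] by simp
next
  case (Suc n)
  define i where "i = a + Suc n"
  have i: "2 \<le> i" "i \<le> j" "a < i" "i - 1 = a + n" using Suc.prems a by (auto simp: i_def)
  define D where "D i s = (\<integral>\<omega>. vacant i j (X s \<omega>) \<partial>\<Omega>) - exp (- ((\<Sum>k=i..j. p k) + q) * s) * W i s"
    for i s
  have "{i - 1..j} = insert (i - 1) {i..j}" "i - 1 \<notin> {i..j}" using i by auto
  \<comment> \<open>The extra \<open>p (i - 1)\<close> in the exponent of the longer arc matches the
    factor \<open>exp (- p (i - 1) * s)\<close> in the equation for \<open>W i\<close>. Hence the
    approximations obey the same hierarchy as the probabilities, and so do the differences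
    \<open>D\<close>.\<close>
  then have sum: "(\<Sum>k=i - 1..j. p k) = p (i - 1) + (\<Sum>k=i..j. p k)" by simp
  have "C \<ge> 0" using C[of 0] Suc.prems by auto
  have "\<bar>D i t\<bar> \<le> (C + 1) * (q * t) ^ Suc n / fact (Suc n)"
  proof (rule linear_ode_power_bound)
    fix s :: real assume s: "s \<ge> 0"
    show "(D i has_real_derivative - ((\<Sum>k=i..j. p k) + q) * D i s + q * D (i - 1) s) (at s within {0..})"
      unfolding D_def sum
      by (rule derivative_eq_intros refl circle_vacant_deriv[OF X i(1,2) \<open>j \<le> M\<close> s] W[OF i(3,2) s] | simp)+
         (simp add: algebra_simps exp_add exp_diff exp_minus field_simps)
  next
    show "D i 0 = 0" using circle_vacant_0[OF X _ \<open>j \<le> M\<close>, of i] i by (simp add: D_def W0)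
  next
    show "\<bar>D (i - 1) s\<bar> \<le> (C + 1) * (q * s) ^ n / fact n" if "0 \<le> s" "s \<le> t" for s
      using Suc.IH[of s] Suc.prems that unfolding D_def i(4) by simp
  qed (use Suc.prems \<open>q \<ge> 0\<close> \<open>C \<ge> 0\<close> p in \<open>auto intro!: add_nonneg_nonneg sum_nonneg\<close>)
  then show ?case by (simp add: D_def i_def)
qed

text \<open>Node \<open>j\<close> is the arc \<open>j..j\<close>, reached from \<open>a\<close> in
  \<open>j - a\<close> steps. The bounds for single nodes are distinct terms of the series of
  \<open>exp (q * t)\<close>, so the total does not grow with the length of the block.\<close>

lemma circle_block_approx:
  fixes W :: "nat \<Rightarrow> real \<Rightarrow> real"
  assumes X: "one_sided_circle \<Omega> M p (\<lambda>_. q) X" and "q \<ge> 0" and p: "\<And>k. p k \<ge> 0"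
    and "1 \<le> a" "b \<le> M"
    and W: "\<And>i s. a < i \<Longrightarrow> i \<le> b \<Longrightarrow> s \<ge> 0 \<Longrightarrow>
      (W i has_real_derivative q * exp (- p (i - 1) * s) * W (i - 1) s) (at s within {0..})"
    and W0: "\<And>i. W i 0 = 1"
    and C: "\<And>s. 0 \<le> s \<Longrightarrow> s \<le> t \<Longrightarrow> \<bar>W a s\<bar> \<le> C"
    and "0 \<le> t"
  shows "\<bar>(\<Sum>j=a..b. \<integral>\<omega>. vacant j j (X t \<omega>) \<partial>\<Omega>) - (\<Sum>j=a..b. exp (- (p j + q) * t) * W j t)\<bar>
    \<le> (C + 1) * exp (q * t)"
proof -
  have "C \<ge> 0" using C[of 0] \<open>0 \<le> t\<close> by auto
  have "\<bar>(\<Sum>j=a..b. \<integral>\<omega>. vacant j j (X t \<omega>) \<partial>\<Omega>) - (\<Sum>j=a..b. exp (- (p j + q) * t) * W j t)\<bar>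
      \<le> (\<Sum>j=a..b. \<bar>(\<integral>\<omega>. vacant j j (X t \<omega>) \<partial>\<Omega>) - exp (- (p j + q) * t) * W j t\<bar>)"
    unfolding sum_subtractf[symmetric] by (rule sum_abs)
  also have "\<dots> \<le> (\<Sum>j=a..b. (C + 1) * ((q * t) ^ (j - a) / fact (j - a)))"
  proof (rule sum_mono)
    fix j assume j: "j \<in> {a..b}"
    then have "a + (j - a) = j" by simp
    with circle_vacant_approx[OF X \<open>q \<ge> 0\<close> p \<open>1 \<le> a\<close>, where n = "j - a" and j = j and W = W
        and T = t and C = C and t = t] j assms
    show "\<bar>(\<integral>\<omega>. vacant j j (X t \<omega>) \<partial>\<Omega>) - exp (- (p j + q) * t) * W j t\<bar>
        \<le> (C + 1) * ((q * t) ^ (j - a) / fact (j - a))"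
      by simp
  qed
  also have "\<dots> = (C + 1) * (\<Sum>m\<in>(\<lambda>j. j - a) ` {a..b}. (q * t) ^ m / fact m)"
    by (subst sum.reindex) (auto simp: sum_distrib_left inj_on_def)
  also have "\<dots> \<le> (C + 1) * exp (q * t)"
  proof (rule mult_left_mono)
    have "(\<lambda>n. (q * t) ^ n / fact n) sums exp (q * t)"
      using exp_converges[of "q * t"] by (simp add: scaleR_conv_of_real divide_inverse mult.commute)
    then show "(\<Sum>m\<in>(\<lambda>j. j - a) ` {a..b}. (q * t) ^ m / fact m) \<le> exp (q * t)"
      using \<open>q \<ge> 0\<close> \<open>0 \<le> t\<close>
      by (metis (no_types, lifting) sums_unique sums_summable sum_le_suminf finite_imageI finite_atLeastAtMost
          divide_nonneg_nonneg fact_ge_zero mult_nonneg_nonneg zero_le_power)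
  qed (use \<open>C \<ge> 0\<close> in simp)
  finally show ?thesis .
qed

section \<open>Limits of averages over the nodes\<close>

lemma tendsto_of_abs_le_divide_nat:
  fixes f :: "nat \<Rightarrow> real"
  assumes "\<And>M. M \<ge> 1 \<Longrightarrow> \<bar>f M - L\<bar> \<le> K / real M"
  shows "f \<longlonglongrightarrow> L"
proof -
  have "(\<lambda>M. f M - L) \<longlonglongrightarrow> 0"
  proof (rule Lim_null_comparison)
    show "(\<lambda>M. K / real M) \<longlonglongrightarrow> 0" by (rule lim_const_over_n)
    show "\<forall>\<^sub>F M in sequentially. norm (f M - L) \<le> K / real M"
      using assms by (auto intro!: eventually_sequentiallyI[of 1])
  qed
  then show ?thesis by (simp add: LIM_zero_iff)
qed

text \<open>Serves both circles: \<open>u\<close> and \<open>v\<close> are the vacancy limits of the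
  two kinds of nodes. The error \<open>K\<close>, uniform in \<open>M\<close>, and the rounding of
  \<open>M / 2\<close> vanish after division by \<open>M\<close>.\<close>

lemma half_average_limit:
  fixes f S :: "nat \<Rightarrow> real"
  assumes "\<And>M. M \<ge> 1 \<Longrightarrow> f M = 1 - S M / real M"
    and "\<And>M. M \<ge> 1 \<Longrightarrow> \<bar>S M - (real (M div 2) * u + real (M - M div 2) * v)\<bar> \<le> K"
  shows "f \<longlonglongrightarrow> 1 - (u + v) / 2"
proof (rule tendsto_of_abs_le_divide_nat)
  fix M :: nat assume M: "M \<ge> 1"
  define R where "R = S M - (real (M div 2) * u + real (M - M div 2) * v)"
  define d where "d = real (M div 2) - real M / 2"
  have "\<bar>d\<bar> \<le> 1"
    unfolding d_def using real_of_nat_div[of 2 M] by (cases "even M") (auto elim!: evenE oddE)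
  have "real (M - M div 2) = real M - real (M div 2)" by (simp add: of_nat_diff)
  then have "f M - (1 - (u + v) / 2) = - (R + d * (u - v)) / real M"
    using M by (simp add: assms(1) R_def d_def field_simps)
  moreover have "\<bar>R + d * (u - v)\<bar> \<le> K + 1 * \<bar>u - v\<bar>"
    using assms(2)[OF M] \<open>\<bar>d\<bar> \<le> 1\<close>
    by (intro order.trans[OF abs_triangle_ineq] add_mono)
       (auto simp: R_def abs_mult intro: mult_left_le_one_le)
  ultimately show "\<bar>f M - (1 - (u + v) / 2)\<bar> \<le> (K + \<bar>u - v\<bar>) / real M"
    using M by (simp add: divide_right_mono)
qed

lemma sum_alternating:
  "(\<Sum>j=1..M. if odd j then v else u) = real (M div 2) * u + real (M - M div 2) * (v :: real)"
proof (induction M)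
  case (Suc M)
  then show ?case
    by (cases "even M") (auto elim!: evenE oddE simp: algebra_simps)
qed simp

section \<open>The two heterogeneous circles\<close>

theorem lemma15:
  fixes p1 p2 q :: real
    and \<Omega>A :: "nat \<Rightarrow> 'a measure" and XA :: "nat \<Rightarrow> real \<Rightarrow> 'a \<Rightarrow> nat \<Rightarrow> nat"
    and \<Omega>B :: "nat \<Rightarrow> 'b measure" and XB :: "nat \<Rightarrow> real \<Rightarrow> 'b \<Rightarrow> nat \<Rightarrow> nat"
    and U V dU dV :: "real \<Rightarrow> real" and t :: real
  assumes "p1 > 0" and "p2 > 0" and "q > 0"
    and A: "\<And>M. M \<ge> 1 \<Longrightarrow>
      one_sided_circle (\<Omega>A M) M (\<lambda>i. if real i \<le> real M / 2 then p1 else p2) (\<lambda>_. q) (XA M)"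
    and B: "\<And>M. M \<ge> 1 \<Longrightarrow>
      one_sided_circle (\<Omega>B M) M (\<lambda>i. if odd i then p1 else p2) (\<lambda>_. q) (XB M)"
    and dU: "\<And>s. s \<ge> 0 \<Longrightarrow> (U has_real_derivative dU s) (at s within {0..})"
    and dV: "\<And>s. s \<ge> 0 \<Longrightarrow> (V has_real_derivative dV s) (at s within {0..})"
    and U: "\<And>s. s \<ge> 0 \<Longrightarrow> dU s = q * exp (- p1 * s) * V s" "U 0 = 1"
    and V: "\<And>s. s \<ge> 0 \<Longrightarrow> dV s = q * exp (- p2 * s) * U s" "V 0 = 1"
    and "t \<ge> 0"
  shows "((\<lambda>M. adopter_fraction (\<Omega>A M) M (XA M) t) \<longlonglongrightarrow> (f_1D t p1 q + f_1D t p2 q) / 2) \<and>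
         ((\<lambda>M. adopter_fraction (\<Omega>B M) M (XB M) t) \<longlonglongrightarrow>
            1 - 1 / (2 * q) * exp (- q * t) * (dV t + dU t))"
proof
  \<comment> \<open>For constant \<open>p\<close> a single function, the same for every
    \<open>i\<close>, solves the hierarchy.\<close>
  have exp_W: "((\<lambda>s. exp (q * ((1 - exp (- p * s)) / p))) has_real_derivative
      q * exp (- p * s) * exp (q * ((1 - exp (- p * s)) / p))) (at s within {0..})"
    if "p > 0" for p s
    by (rule derivative_eq_intros refl | use that in simp)+
  have exp_bound: "\<bar>exp (q * ((1 - exp (- p * s)) / p))\<bar> \<le> exp (q / p)" if "p > 0" for p s
    using that \<open>q > 0\<close> by (simp add: field_simps)
  define W where "W p s = exp (q * ((1 - exp (- p * s)) / p))" for p s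
  \<comment> \<open>\<open>v p\<close> equals \<open>1 - f_1D t p q\<close>.\<close>
  define v where "v p = exp (- (p + q) * t) * W p t" for p
  define K where "K p = (exp (q / p) + 1) * exp (q * t)" for p
  have "(\<lambda>M. adopter_fraction (\<Omega>A M) M (XA M) t) \<longlonglongrightarrow> 1 - (v p1 + v p2) / 2"
  proof (rule half_average_limit)
    fix M :: nat assume M: "M \<ge> 1"
    define S where "S a b = (\<Sum>j=a..b. \<integral>\<omega>. vacant j j (XA M t \<omega>) \<partial>\<Omega>A M)" for a b
    define p where "p i = (if real i \<le> real M / 2 then p1 else p2)" for i
    have p_eq: "p i = (if i \<le> M div 2 then p1 else p2)" for i
      by (auto simp: p_def)
    have X: "one_sided_circle (\<Omega>A M) M p (\<lambda>_. q) (XA M)"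
      using A[OF M] by (simp add: p_def[abs_def])
    show "adopter_fraction (\<Omega>A M) M (XA M) t = 1 - S 1 M / real M"
      unfolding S_def by (rule adopter_fraction_vacant[OF X \<open>t \<ge> 0\<close> M])
    \<comment> \<open>Each half of the circle is a block of its own with constant rate. The
      hierarchy is required only for \<open>a < i\<close>, so the rate of the node before the block
      is never read; the boundary effect is absorbed in \<open>K p'\<close>.\<close>
    have block: "\<bar>S a b - real (Suc b - a) * v p'\<bar> \<le> K p'"
      if "1 \<le> a" "b \<le> M" "p' > 0" and p': "\<And>i. a \<le> i \<Longrightarrow> i \<le> b \<Longrightarrow> p i = p'" for a b p'
    proof -
      have "\<bar>(\<Sum>j=a..b. \<integral>\<omega>. vacant j j (XA M t \<omega>) \<partial>\<Omega>A M) -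
          (\<Sum>j=a..b. exp (- (p j + q) * t) * W p' t)\<bar> \<le> (exp (q / p') + 1) * exp (q * t)"
      proof (rule circle_block_approx[OF X])
        fix i and s :: real assume "a < i" "i \<le> b"
        then have "p (i - 1) = p'" by (intro p') auto
        then show "(W p' has_real_derivative q * exp (- p (i - 1) * s) * W p' s) (at s within {0..})"
          using exp_W[OF \<open>p' > 0\<close>] by (simp add: W_def[abs_def])
      qed (use that assms exp_bound in \<open>auto simp: W_def p_def\<close>)
      moreover have "(\<Sum>j=a..b. exp (- (p j + q) * t) * W p' t) = (\<Sum>j=a..b. v p')"
        by (rule sum.cong) (auto simp: v_def p')
      ultimately show ?thesis by (simp add: S_def K_def)
    qed
    have "S 1 M = S 1 (M div 2) + S (M div 2 + 1) M"
      using sum.ub_add_nat[of 1 "M div 2" "\<lambda>j. \<integral>\<omega>. vacant j j (XA M t \<omega>) \<partial>\<Omega>A M" "M - M div 2"]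
      by (simp add: S_def)
    moreover have "\<bar>S 1 (M div 2) - real (M div 2) * v p1\<bar> \<le> K p1"
      using block[of 1 "M div 2" p1] assms(1) by (simp add: p_eq)
    moreover have "\<bar>S (M div 2 + 1) M - real (M - M div 2) * v p2\<bar> \<le> K p2"
      using block[of "M div 2 + 1" M p2] assms(2) by (simp add: p_eq)
    ultimately show "\<bar>S 1 M - (real (M div 2) * v p1 + real (M - M div 2) * v p2)\<bar> \<le> K p1 + K p2"
      by linarith
  qed
  also have "1 - (v p1 + v p2) / 2 = (f_1D t p1 q + f_1D t p2 q) / 2"
    by (simp add: v_def W_def f_1D_def exp_add[symmetric] field_simps)
  finally show "(\<lambda>M. adopter_fraction (\<Omega>A M) M (XA M) t) \<longlonglongrightarrow> (f_1D t p1 q + f_1D t p2 q) / 2" .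
next
  \<comment> \<open>Node 1 is odd, so \<open>V\<close> is the approximation there, and the block
    estimate needs a bound for it up to time \<open>t\<close>.\<close>
  have "continuous_on {0..t} V"
    by (rule DERIV_continuous_on, rule DERIV_subset[OF dV]) auto
  then have "bounded (V ` {0..t})"
    by (intro compact_imp_bounded compact_continuous_image compact_Icc)
  then obtain C where C: "\<And>s. 0 \<le> s \<Longrightarrow> s \<le> t \<Longrightarrow> \<bar>V s\<bar> \<le> C"
    unfolding bounded_iff by (metis atLeastAtMost_iff imageI real_norm_def)
  \<comment> \<open>The predecessor of an odd node has rate \<open>p2\<close>, as in the equation
    for \<open>V\<close>; that of an even node \<open>i > 1\<close> has rate \<open>p1\<close>, as
    for \<open>U\<close>. So all of \<open>1..M\<close> forms one block.\<close>
  define W where "W i = (if odd i then V else U)" for i :: nat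
  define u v where "u = exp (- (p2 + q) * t) * U t" and "v = exp (- (p1 + q) * t) * V t"
  have "(\<lambda>M. adopter_fraction (\<Omega>B M) M (XB M) t) \<longlonglongrightarrow> 1 - (u + v) / 2"
  proof (rule half_average_limit)
    fix M :: nat assume M: "M \<ge> 1"
    let ?S = "\<Sum>j=1..M. \<integral>\<omega>. vacant j j (XB M t \<omega>) \<partial>\<Omega>B M"
    show "adopter_fraction (\<Omega>B M) M (XB M) t = 1 - ?S / real M"
      by (rule adopter_fraction_vacant[OF B[OF M] \<open>t \<ge> 0\<close> M])
    have "\<bar>?S - (\<Sum>j=1..M. exp (- ((if odd j then p1 else p2) + q) * t) * W j t)\<bar>
        \<le> (C + 1) * exp (q * t)"
    proof (rule circle_block_approx[OF B[OF M]])
      fix i :: nat and s :: real assume "1 < i" "s \<ge> 0"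
      then show "(W i has_real_derivative q * exp (- (if odd (i - 1) then p1 else p2) * s) * W (i - 1) s)
          (at s within {0..})"
        using dU[of s] dV[of s] U(1)[of s] V(1)[of s] by (auto simp: W_def)
    qed (use assms C in \<open>auto simp: W_def\<close>)
    moreover have "(\<Sum>j=1..M. exp (- ((if odd j then p1 else p2) + q) * t) * W j t) =
        (\<Sum>j=1..M. if odd j then v else u)"
      by (rule sum.cong) (auto simp: W_def u_def v_def)
    ultimately show "\<bar>?S - (real (M div 2) * u + real (M - M div 2) * v)\<bar> \<le> (C + 1) * exp (q * t)"
      by (simp only: sum_alternating)
  qed
  \<comment> \<open>The differential equations at time \<open>t\<close> turn
    \<open>exp (- p2 * t) * U t\<close> into \<open>dV t / q\<close> and
    \<open>exp (- p1 * t) * V t\<close> into \<open>dU t / q\<close>.\<close>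
  also have "1 - (u + v) / 2 = 1 - 1 / (2 * q) * exp (- q * t) * (dV t + dU t)"
    using \<open>q > 0\<close> \<open>t \<ge> 0\<close>
    by (simp add: U V u_def v_def algebra_simps exp_add exp_diff exp_minus field_simps)
  finally show "(\<lambda>M. adopter_fraction (\<Omega>B M) M (XB M) t) \<longlonglongrightarrow>
      1 - 1 / (2 * q) * exp (- q * t) * (dV t + dU t)" .
qed

end
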